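(* Let $d,r \in \mathbb{N}$ and let $M \ge 2^r r!$ be a real number. Then $$ e^{\rm det}(n, F^r_{M,d}) = 1 \qquad \text{for } n = 1,2,\dots,2^d-1. $$
   Context: $\mathbb{N}=\{1,2,\dots\}$. For $r\in\mathbb{N}$, $W^r_\infty[0,1]$ is the set of all (continuous) functions $g:[0,1]\to\mathbb{R}$ which have $r$ weak derivatives in $L_\infty$; $g^{(r)}$ denotes the $r$th weak derivative. For $d\in\mathbb{N}$ and $M>0$, $F^r_{M,d}$ is the set of all functions $f:[0,1]^d\to\mathbb{R}$ of the form $f(x_1,\dots,x_d)=\prod_{i=1}^d f_i(x_i)$ with $f_i\in W^r_\infty[0,1]$, $\|f_i\|_\infty\le 1$ and $\|f_i^{(r)}\|_\infty\le M$ for all $i=1,\dots,d$. A deterministic algorithm $A_n$ using at most $n$ function values is a map of the form $A_n(f)=\phi(f(x_1),\dots,f(x_n))$ with an arbitrary $\phi:\mathbb{R}^n\to L_\infty([0,1]^d)$, where the points $x_i\in[0,1]^d$ may be chosen adaptively, i.e. $x_i$ may depend on the already known values $f(x_1),\dots,f(x_{i-1})$ ($x_1$ is fixed). For a class $F_d$ of functions on $[0,1]^d$, the worst case error is $e^{\rm det}(A_n,F_d)=\sup_{f\in F_d}\|f-A_n(f)\|_\infty$, and $e^{\rm det}(n,F_d)=\inf_{A_n} e^{\rm det}(A_n,F_d)$, where the infimum is over all deterministic algorithms that use at most $n$ function values. *)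

theory Defs
  imports "HOL-Analysis.Analysis" "HOL-Probability.Essential_Supremum"
begin

text \<open>The essential supremum norm over \<open>S\<close> with respect to Lebesgue measure. Elements of
  \<open>Linf S\<close> are represented by functions rather than by equivalence classes; only the values on \<open>S\<close>
  matter, and \<open>Linf_norm S\<close> does not distinguish functions that agree almost everywhere on \<open>S\<close>.\<close>

definition Linf_norm :: "'a::euclidean_space set \<Rightarrow> ('a \<Rightarrow> real) \<Rightarrow> ereal" where
  "Linf_norm S f = esssup (lebesgue_on S) (\<lambda>x. ereal \<bar>f x\<bar>)"

definition Linf :: "'a::euclidean_space set \<Rightarrow> ('a \<Rightarrow> real) set" where
  "Linf S = {f \<in> borel_measurable (lebesgue_on S). Linf_norm S f < \<infinity>}"

text \<open>Infinitely differentiable functions with compact support in the open unit interval.\<close>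

definition test_function :: "(real \<Rightarrow> real) \<Rightarrow> bool" where
  "test_function \<phi> \<longleftrightarrow>
     (\<forall>k x. (deriv ^^ k) \<phi> differentiable (at x)) \<and>
     closure {x. \<phi> x \<noteq> 0} \<subseteq> {0<..<1}"

text \<open>\<open>h\<close> is a \<open>k\<close>-th weak derivative of \<open>g\<close> on the open unit interval. Local integrability is
  required explicitly, since the Lebesgue integral of a non-integrable function is \<open>0\<close> by convention.\<close>

definition locally_integrable01 :: "(real \<Rightarrow> real) \<Rightarrow> bool" where
  "locally_integrable01 g \<longleftrightarrow> (\<forall>a b. 0 < a \<longrightarrow> b < 1 \<longrightarrow> set_integrable lebesgue {a..b} g)"

definition has_weak_deriv :: "nat \<Rightarrow> (real \<Rightarrow> real) \<Rightarrow> (real \<Rightarrow> real) \<Rightarrow> bool" where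
  "has_weak_deriv k g h \<longleftrightarrow>
     locally_integrable01 g \<and> locally_integrable01 h \<and>
     (\<forall>\<phi>. test_function \<phi> \<longrightarrow>
        (LINT x:{0<..<1}|lebesgue. g x * (deriv ^^ k) \<phi> x)
          = (-1) ^ k * (LINT x:{0<..<1}|lebesgue. h x * \<phi> x))"

definition W_inf :: "nat \<Rightarrow> (real \<Rightarrow> real) set" where
  "W_inf r = {g. continuous_on {0..1} g \<and>
                 (\<forall>k\<in>{1..r}. \<exists>h \<in> Linf {0..1}. has_weak_deriv k g h)}"

text \<open>The unit cube is \<open>cbox 0 1\<close>, where \<open>1\<close> is the vector all of whose entries are \<open>1\<close>.
  Weak derivatives are unique up to null sets, so the norm of \<open>h\<close> below does not depend on the
  choice of \<open>h\<close>. The values of \<open>f\<close> outside the cube are irrelevant for everything that follows.\<close>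

definition F_class :: "nat \<Rightarrow> real \<Rightarrow> (real ^ 'd \<Rightarrow> real) set" where
  "F_class r M = {f. \<exists>fs :: 'd \<Rightarrow> real \<Rightarrow> real.
      (\<forall>i. fs i \<in> W_inf r \<and> Linf_norm {0..1} (fs i) \<le> 1 \<and>
           (\<exists>h. has_weak_deriv r (fs i) h \<and> h \<in> Linf {0..1} \<and> Linf_norm {0..1} h \<le> ereal M)) \<and>
      (\<forall>x \<in> cbox 0 1. f x = (\<Prod>i\<in>UNIV. fs i (x $ i)))}"

text \<open>Adaptive information: \<open>\<psi> [y\<^sub>1, \<dots>, y\<^sub>i]\<close> is the sample point chosen after the values
  \<open>y\<^sub>1, \<dots>, y\<^sub>i\<close> have been observed; in particular the first point \<open>\<psi> []\<close> is fixed.\<close>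

primrec info :: "(real list \<Rightarrow> 'a) \<Rightarrow> ('a \<Rightarrow> real) \<Rightarrow> nat \<Rightarrow> real list" where
  "info \<psi> f 0 = []"
| "info \<psi> f (Suc n) = info \<psi> f n @ [f (\<psi> (info \<psi> f n))]"

text \<open>Algorithms using fewer than \<open>n\<close> values are included: \<open>\<phi>\<close> may ignore entries of its argument.\<close>

definition det_algorithms :: "nat \<Rightarrow> ((real ^ 'd \<Rightarrow> real) \<Rightarrow> (real ^ 'd \<Rightarrow> real)) set" where
  "det_algorithms n = {A. \<exists>\<psi> \<phi>.
      (\<forall>ys. \<psi> ys \<in> cbox 0 1) \<and>
      (\<forall>ys. length ys = n \<longrightarrow> \<phi> ys \<in> Linf (cbox 0 1)) \<and>
      (\<forall>f. A f = \<phi> (info \<psi> f n))}"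

definition e_det_alg ::
  "((real ^ 'd \<Rightarrow> real) \<Rightarrow> (real ^ 'd \<Rightarrow> real)) \<Rightarrow> (real ^ 'd \<Rightarrow> real) set \<Rightarrow> ereal" where
  "e_det_alg A F = (SUP f\<in>F. Linf_norm (cbox 0 1) (\<lambda>x. f x - A f x))"

definition e_det :: "nat \<Rightarrow> (real ^ 'd \<Rightarrow> real) set \<Rightarrow> ereal" where
  "e_det n F = (INF A\<in>det_algorithms n. e_det_alg A F)"

end

theory Submission
  imports Defs
begin

text \<open>The truncated powers \<open>(1 - 2x)\<^sub>+\<^sup>r\<close> and \<open>(2x - 1)\<^sub>+\<^sup>r\<close> have sup norm \<open>1\<close> and an \<open>r\<close>-th weak
  derivative bounded by \<open>2\<^sup>r r!\<close>. Choosing one of them in each coordinate gives \<open>2\<^sup>d\<close> functions in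
  the class with pairwise disjoint nonzero sets, each attaining \<open>1\<close> at a vertex of the cube. If an
  algorithm sees only zeros at fewer than \<open>2\<^sup>d\<close> points, some function \<open>f\<close> among these vanishes at all
  of them; then \<open>f\<close> and \<open>-f\<close> get the same approximation, and one of the two errors is at least \<open>1\<close>.
  The zero algorithm attains the bound.\<close>

section \<open>The supremum norm\<close>

lemma Linf_norm_leI:
  assumes "f \<in> borel_measurable (lebesgue_on S)" "S \<in> sets lebesgue" "\<And>x. x \<in> S \<Longrightarrow> \<bar>f x\<bar> \<le> c"
  shows "Linf_norm S f \<le> ereal c"
  unfolding Linf_norm_def
proof (rule esssup_I)
  show "(\<lambda>x. ereal \<bar>f x\<bar>) \<in> borel_measurable (lebesgue_on S)"
    using assms(1) by measurable
  show "AE x in lebesgue_on S. ereal \<bar>f x\<bar> \<le> ereal c"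
    using assms(2,3) by (intro AE_I2) auto
qed

lemma LinfI:
  assumes "f \<in> borel_measurable (lebesgue_on S)" "S \<in> sets lebesgue" "\<And>x. x \<in> S \<Longrightarrow> \<bar>f x\<bar> \<le> c"
  shows "f \<in> Linf S"
  using Linf_norm_leI[OF assms] assms(1) unfolding Linf_def by (auto intro: le_less_trans)

lemma Linf_norm_AE_le:
  assumes "S \<in> sets lebesgue" "Linf_norm S f \<le> ereal c"
  shows "AE x in lebesgue. x \<in> S \<longrightarrow> \<bar>f x\<bar> \<le> c"
proof -
  have "AE x in lebesgue_on S. ereal \<bar>f x\<bar> \<le> Linf_norm S f"
    unfolding Linf_norm_def by (rule esssup_AE)
  then have "AE x in lebesgue_on S. \<bar>f x\<bar> \<le> c"
    by eventually_elim (metis assms(2) ereal_less_eq(3) order_trans)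
  then show ?thesis
    using assms(1) by (simp add: AE_restrict_space_iff)
qed

text \<open>By continuity the set where the bound holds is closed. It contains almost every point of
  the open box, hence the whole open box, hence its closure \<open>cbox a b\<close>. This turns norm
  bounds into pointwise ones, including on the boundary.\<close>

lemma continuous_AE_bound_cbox:
  fixes f :: "'a::euclidean_space \<Rightarrow> real"
  assumes cont: "continuous_on (cbox a b) f" and ne: "box a b \<noteq> {}"
    and AE: "AE x in lebesgue. x \<in> cbox a b \<longrightarrow> \<bar>f x\<bar> \<le> c"
    and x: "x \<in> cbox a b"
  shows "\<bar>f x\<bar> \<le> c"
proof -
  define C where "C = {x \<in> cbox a b. \<bar>f x\<bar> \<le> c}"
  have "closed C"
    unfolding C_def
    by (intro continuous_on_closed_Collect_le continuous_on_rabs cont continuous_on_const closed_cbox)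
  moreover have "AE x \<in> box a b in lebesgue. x \<in> C"
    using AE by eventually_elim (use box_subset_cbox in \<open>auto simp: C_def\<close>)
  ultimately have "box a b \<subseteq> C"
    using mem_closed_if_AE_lebesgue_open[OF open_box] by blast
  then have "closure (box a b) \<subseteq> C"
    using \<open>closed C\<close> by (rule closure_minimal)
  then show ?thesis
    using x ne by (auto simp: closure_box C_def)
qed

section \<open>Weak derivatives\<close>

lemma test_function_has_derivative:
  assumes "test_function \<phi>"
  shows "(\<phi> has_real_derivative deriv \<phi> x) (at x)"
  using assms unfolding test_function_def
  by (metis DERIV_deriv_iff_real_differentiable funpow_0)

text \<open>Differentiation does not enlarge the support: off the closure of its nonzero set,
  \<open>\<phi>\<close> vanishes on a neighbourhood, and so does its derivative. This closure
  property allows weak derivatives to be iterated.\<close>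

lemma test_function_deriv:
  assumes "test_function \<phi>"
  shows "test_function (deriv \<phi>)"
proof -
  have "(deriv ^^ k) (deriv \<phi>) differentiable (at x)" for k x
    using assms unfolding test_function_def
    by (metis comp_apply funpow_Suc_right)
  moreover have "{x. deriv \<phi> x \<noteq> 0} \<subseteq> closure {x. \<phi> x \<noteq> 0}"
  proof
    fix x assume x: "x \<in> {x. deriv \<phi> x \<noteq> 0}"
    show "x \<in> closure {x. \<phi> x \<noteq> 0}"
    proof (rule ccontr)
      assume nx: "x \<notin> closure {x. \<phi> x \<noteq> 0}"
      have "(\<phi> has_real_derivative 0) (at x)"
        by (rule has_field_derivative_transform_within_open[of "\<lambda>_. 0" _ _ "- closure {x. \<phi> x \<noteq> 0}"])
          (use nx closure_subset[of "{x. \<phi> x \<noteq> 0}"] in auto)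
      then show False
        using x DERIV_imp_deriv by auto
    qed
  qed
  ultimately show ?thesis
    using assms unfolding test_function_def
    by (meson closed_closure closure_minimal subset_trans)
qed

lemma test_function_continuous:
  assumes "test_function \<phi>"
  shows "continuous_on S \<phi>"
  using DERIV_continuous_on has_field_derivative_at_within[OF test_function_has_derivative[OF assms]]
  by blast

lemma test_function_zero_outside:
  assumes "test_function \<phi>" "x \<notin> {0<..<1}"
  shows "\<phi> x = 0"
  using assms closure_subset[of "{x. \<phi> x \<noteq> 0}"] unfolding test_function_def by blast

lemma locally_integrable01_if_integrable:
  assumes "set_integrable lebesgue {0..1} f"
  shows "locally_integrable01 f"
  unfolding locally_integrable01_def
  by (auto intro!: set_integrable_subset[OF assms])

lemma has_weak_deriv_0:
  assumes "locally_integrable01 f"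
  shows "has_weak_deriv 0 f f"
  using assms by (simp add: has_weak_deriv_def)

text \<open>The \<open>k\<close>-th order identity is applied to the test function
  \<open>deriv \<phi>\<close>, then the first order identity to \<open>\<phi>\<close> itself. Higher
  weak derivatives can thus be built one order at a time.\<close>

lemma has_weak_deriv_Suc:
  assumes "has_weak_deriv k f g" "has_weak_deriv 1 g h"
  shows "has_weak_deriv (Suc k) f h"
proof -
  have "(LINT x:{0<..<1}|lebesgue. f x * (deriv ^^ Suc k) \<phi> x)
          = (-1) ^ Suc k * (LINT x:{0<..<1}|lebesgue. h x * \<phi> x)"
    if "test_function \<phi>" for \<phi>
  proof -
    have "(LINT x:{0<..<1}|lebesgue. f x * (deriv ^^ Suc k) \<phi> x)
        = (-1) ^ k * (LINT x:{0<..<1}|lebesgue. g x * deriv \<phi> x)"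
      using assms(1) test_function_deriv[OF that]
      unfolding has_weak_deriv_def funpow_Suc_right comp_def by blast
    also have "(LINT x:{0<..<1}|lebesgue. g x * deriv \<phi> x)
        = - (LINT x:{0<..<1}|lebesgue. h x * \<phi> x)"
      using assms(2) that unfolding has_weak_deriv_def by simp
    finally show ?thesis by simp
  qed
  then show ?thesis
    using assms unfolding has_weak_deriv_def by blast
qed

text \<open>Integration by parts: the fundamental theorem of calculus for
  \<open>g x * \<phi> x\<close> tolerates the finite exceptional set \<open>S\<close>, because
  continuity of \<open>g\<close> rules out contributions from jumps.\<close>

lemma has_weak_deriv_piecewise:
  assumes cont: "continuous_on {0..1} g" and int: "set_integrable lebesgue {0..1} h"
    and S: "finite S" and deriv: "\<And>x. x \<in> {0..1} - S \<Longrightarrow> (g has_real_derivative h x) (at x)"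
  shows "has_weak_deriv 1 g h"
  unfolding has_weak_deriv_def
proof (intro conjI allI impI)
  show "locally_integrable01 g" "locally_integrable01 h"
    using absolutely_integrable_continuous_real[OF cont] int
    by (auto intro: locally_integrable01_if_integrable)
  fix \<phi> assume \<phi>: "test_function \<phi>"
  note cont_\<phi> = test_function_continuous[OF \<phi>]
  note cont_\<phi>' = test_function_continuous[OF test_function_deriv[OF \<phi>]]
  have i1: "set_integrable lebesgue {0..1} (\<lambda>x. g x * deriv \<phi> x)"
    by (intro absolutely_integrable_continuous_real continuous_intros cont cont_\<phi>')
  have "set_integrable lebesgue {0..1} (\<lambda>x. \<phi> x * h x)"
    by (intro absolutely_integrable_bounded_measurable_product_real int compact_imp_bounded
        compact_continuous_image cont_\<phi> continuous_imp_measurable_on_sets_lebesgue) auto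
  then have i2: "set_integrable lebesgue {0..1} (\<lambda>x. h x * \<phi> x)"
    by (simp add: mult.commute)
  \<comment> \<open>Weak derivatives are tested by Lebesgue integrals over the open interval,
    whereas the fundamental theorem uses gauge integrals over the closed one.\<close>
  have LINT: "(LINT x:{0<..<1}|lebesgue. f x) = integral {0..1} f"
    if "set_integrable lebesgue {0..1} f" for f :: "real \<Rightarrow> real"
  proof -
    have "set_integrable lebesgue {0<..<1} f"
      by (rule set_integrable_subset[OF that]) auto
    then show ?thesis
      by (simp add: set_lebesgue_integral_eq_integral(2) integral_open_interval_real)
  qed
  have "((\<lambda>x. g x * deriv \<phi> x + h x * \<phi> x) has_integral g 1 * \<phi> 1 - g 0 * \<phi> 0) {0..1}"
  proof (rule fundamental_theorem_of_calculus_strong[OF S])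
    show "continuous_on {0..1} (\<lambda>x. g x * \<phi> x)"
      by (intro continuous_intros cont cont_\<phi>)
    fix x assume "x \<in> {0..1} - S"
    show "((\<lambda>x. g x * \<phi> x) has_vector_derivative g x * deriv \<phi> x + h x * \<phi> x) (at x)"
      unfolding has_real_derivative_iff_has_vector_derivative[symmetric]
      using DERIV_mult[OF deriv[OF \<open>x \<in> {0..1} - S\<close>] test_function_has_derivative[OF \<phi>]]
      by (simp add: algebra_simps)
  qed simp
  \<comment> \<open>The boundary terms drop out since \<open>\<phi>\<close> vanishes at
    \<open>0\<close> and \<open>1\<close>.\<close>
  then have "integral {0..1} (\<lambda>x. g x * deriv \<phi> x + h x * \<phi> x) = 0"
    using test_function_zero_outside[OF \<phi>, of 0] test_function_zero_outside[OF \<phi>, of 1]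
    by (simp add: integral_unique)
  then have "integral {0..1} (\<lambda>x. g x * deriv \<phi> x) + integral {0..1} (\<lambda>x. h x * \<phi> x) = 0"
    using i1 i2 by (simp add: Henstock_Kurzweil_Integration.integral_add
        set_lebesgue_integral_eq_integral(1))
  then show "(LINT x:{0<..<1}|lebesgue. g x * (deriv ^^ 1) \<phi> x)
          = (-1) ^ 1 * (LINT x:{0<..<1}|lebesgue. h x * \<phi> x)"
    using LINT[OF i1] LINT[OF i2] by simp
qed

section \<open>Truncated powers\<close>

text \<open>The case distinction makes \<open>tpow a b 0\<close> an indicator function, in spite of \<open>0 ^ 0 = 1\<close>.\<close>

definition tpow :: "real \<Rightarrow> real \<Rightarrow> nat \<Rightarrow> real \<Rightarrow> real" where
  "tpow a b m x = (if 0 < a + b * x then (a + b * x) ^ m else 0)"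

lemma tpow_measurable [measurable]: "tpow a b m \<in> borel_measurable borel"
  unfolding tpow_def by measurable

lemma tpow_measurable_lebesgue_on: "tpow a b m \<in> borel_measurable (lebesgue_on S)"
  using tpow_measurable by (simp add: borel_measurable_if_D measurable_completion measurable_restrict_space1)

lemma tpow_Suc_eq_max: "tpow a b (Suc m) x = max 0 (a + b * x) ^ Suc m"
  by (auto simp: tpow_def max_def)

lemma tpow_Suc_continuous: "continuous_on S (tpow a b (Suc m))"
  unfolding tpow_Suc_eq_max by (intro continuous_intros)

lemma tpow_Suc_has_derivative:
  assumes "a + b * x \<noteq> 0"
  shows "(tpow a b (Suc m) has_real_derivative (real (Suc m) * b * tpow a b m x)) (at x)"
proof (cases "0 < a + b * x")
  case True
  have "((\<lambda>x. (a + b * x) ^ Suc m) has_real_derivative (real (Suc m) * b * tpow a b m x)) (at x)"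
    using True by (auto intro!: derivative_eq_intros simp: tpow_def simp del: power_Suc)
  moreover have "open {x. 0 < a + b * x}"
    by (intro open_Collect_less continuous_intros)
  ultimately show ?thesis
    by (rule has_field_derivative_transform_within_open) (use True in \<open>auto simp: tpow_def\<close>)
next
  case False
  have "((\<lambda>x. 0) has_real_derivative (real (Suc m) * b * tpow a b m x)) (at x)"
    using False by (simp add: tpow_def)
  moreover have "open {x. a + b * x < 0}"
    by (intro open_Collect_less continuous_intros)
  ultimately show ?thesis
    by (rule has_field_derivative_transform_within_open) (use False assms in \<open>auto simp: tpow_def\<close>)
qed

lemma abs_tpow_le_1:
  assumes "a + b * x \<le> 1"
  shows "\<bar>tpow a b m x\<bar> \<le> 1"
  using assms by (auto simp: tpow_def power_le_one)

text \<open>Each differentiation acts on a continuous \<open>tpow a b (Suc j)\<close>, whose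
  derivative can fail to exist only at \<open>- a / b\<close>. The discontinuous
  \<open>tpow a b 0\<close> occurs at most as the final derivative, at \<open>k = m\<close>. The
  bound \<open>le\<close> makes all these functions bounded on the interval, hence
  integrable.\<close>

lemma has_weak_deriv_cmult_tpow:
  assumes le: "\<And>x. x \<in> {0..1} \<Longrightarrow> a + b * x \<le> 1" and "b \<noteq> 0" and "k \<le> m"
  shows "has_weak_deriv k (\<lambda>x. c * tpow a b m x)
           (\<lambda>x. c * b ^ k * (fact m / fact (m - k)) * tpow a b (m - k) x)"
  using \<open>k \<le> m\<close>
proof (induction k)
  have int: "set_integrable lebesgue {0..1} (\<lambda>x. C * tpow a b n x)" for C n
  proof (rule measurable_bounded_by_integrable_imp_absolutely_integrable[of _ _ "\<lambda>_. \<bar>C\<bar>"])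
    show "(\<lambda>x. C * tpow a b n x) \<in> borel_measurable (lebesgue_on {0..1})"
      using tpow_measurable_lebesgue_on by measurable
    show "norm (C * tpow a b n x) \<le> \<bar>C\<bar>" if "x \<in> {0..1}" for x
      using abs_tpow_le_1[OF le[OF that], of n] by (simp add: abs_mult mult_left_le)
  qed auto
  {
    case 0
    then show ?case
      using has_weak_deriv_0[OF locally_integrable01_if_integrable[OF int]] by simp
  next
    case (Suc k)
    define C where "C = c * b ^ k * (fact m / fact (m - k))"
    obtain j where j: "m - k = Suc j"
      using Suc.prems by (metis Suc_diff_Suc Suc_le_lessD)
    \<comment> \<open>\<open>C\<close> contains the denominator \<open>fact (Suc j)\<close>; passing
      to \<open>fact j\<close> absorbs the factor \<open>Suc j\<close> produced by
      differentiation.\<close>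
    have C: "c * b ^ Suc k * (fact m / fact j) = C * (real (Suc j) * b)"
      by (simp add: C_def j field_simps del: of_nat_Suc)
    have "has_weak_deriv 1 (\<lambda>x. C * tpow a b (Suc j) x) (\<lambda>x. C * (real (Suc j) * b) * tpow a b j x)"
    proof (rule has_weak_deriv_piecewise[of _ _ "{- a / b}"])
      show "continuous_on {0..1} (\<lambda>x. C * tpow a b (Suc j) x)"
        by (intro continuous_intros tpow_Suc_continuous)
      fix x assume "x \<in> {0..1} - {- a / b}"
      then have "a + b * x \<noteq> 0"
        using \<open>b \<noteq> 0\<close> by (auto simp: field_simps add_eq_0_iff)
      from DERIV_cmult[OF tpow_Suc_has_derivative[OF this], of C]
      show "((\<lambda>x. C * tpow a b (Suc j) x) has_real_derivative C * (real (Suc j) * b) * tpow a b j x) (at x)"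
        by (simp add: mult.assoc)
    qed (auto intro: int)
    moreover have "has_weak_deriv k (\<lambda>x. c * tpow a b m x) (\<lambda>x. C * tpow a b (Suc j) x)"
      using Suc.IH Suc.prems by (simp add: C_def j)
    ultimately have "has_weak_deriv (Suc k) (\<lambda>x. c * tpow a b m x)
        (\<lambda>x. C * (real (Suc j) * b) * tpow a b j x)"
      by (rule has_weak_deriv_Suc[rotated])
    moreover have "m - Suc k = j"
      using j by simp
    ultimately show ?case
      by (simp only: C)
  }
qed

definition half_tpow :: "bool \<Rightarrow> nat \<Rightarrow> real \<Rightarrow> real" where
  "half_tpow u r = (if u then tpow (-1) 2 r else tpow 1 (-2) r)"

lemma half_tpow_eq_0_iff: "half_tpow u r x = 0 \<longleftrightarrow> (if u then x \<le> 1 / 2 else 1 / 2 \<le> x)"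
  by (auto simp: half_tpow_def tpow_def)

text \<open>The factor \<open>c\<close> of modulus \<open>1\<close> is carried along so that the
  same facts serve the fooling functions and their negatives.\<close>

lemma half_tpow_admissible:
  fixes u :: bool and c M :: real
  assumes r: "1 \<le> r" and M: "2 ^ r * fact r \<le> M" and c: "\<bar>c\<bar> = 1"
  defines "g \<equiv> \<lambda>x. c * half_tpow u r x"
  shows "g \<in> W_inf r" "Linf_norm {0..1} g \<le> 1"
    "\<exists>h. has_weak_deriv r g h \<and> h \<in> Linf {0..1} \<and> Linf_norm {0..1} h \<le> ereal M"
proof -
  \<comment> \<open>Both shapes become a single \<open>tpow a b r\<close>, with slope of modulus
    \<open>2\<close> and \<open>a + b * x\<close> at most \<open>1\<close> on the unit
    interval.\<close>
  define a b :: real where "a = (if u then -1 else 1)" and "b = (if u then 2 else -2)"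
  have g: "g = (\<lambda>x. c * tpow a b r x)"
    by (auto simp: g_def half_tpow_def a_def b_def)
  have le: "a + b * x \<le> 1" if "x \<in> {0..1}" for x
    using that by (auto simp: a_def b_def)
  have b: "\<bar>b\<bar> = 2"
    by (simp add: b_def)
  define h where "h k = (\<lambda>x. c * b ^ k * (fact r / fact (r - k)) * tpow a b (r - k) x)" for k
  have weak: "has_weak_deriv k g (h k)" if "k \<le> r" for k
    unfolding g h_def using b by (intro has_weak_deriv_cmult_tpow le that) auto
  have meas: "(\<lambda>x. C * tpow a b n x) \<in> borel_measurable (lebesgue_on {0..1})" for C n
    using tpow_measurable_lebesgue_on by measurable
  have bound: "\<bar>C * tpow a b n x\<bar> \<le> \<bar>C\<bar>" if "x \<in> {0..1}" for C n x
    using abs_tpow_le_1[OF le[OF that], of n] by (simp add: abs_mult mult_left_le)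
  have Linf: "h k \<in> Linf {0..1}" for k
    unfolding h_def by (rule LinfI[OF meas _ bound]) auto
  \<comment> \<open>Continuity needs a positive exponent, since exponent \<open>0\<close> gives a
    jump.\<close>
  obtain r' where "r = Suc r'"
    using r by (cases r) auto
  then have "continuous_on {0..1} g"
    unfolding g by (simp add: continuous_on_mult_left tpow_Suc_continuous)
  moreover have "\<forall>k\<in>{1..r}. \<exists>h \<in> Linf {0..1}. has_weak_deriv k g h"
    using weak Linf by (meson atLeastAtMost_iff)
  ultimately show "g \<in> W_inf r"
    by (simp add: W_inf_def)
  show "Linf_norm {0..1} g \<le> 1"
    using Linf_norm_leI[OF meas _ bound, of c r] c unfolding g by (simp add: one_ereal_def)
  \<comment> \<open>\<open>h r\<close> is \<open>c * b ^ r * fact r\<close> times an indicator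
    function; this is the source of the threshold for \<open>M\<close>.\<close>
  have "Linf_norm {0..1} (h r) \<le> ereal (2 ^ r * fact r)"
    using Linf_norm_leI[OF meas _ bound, of "c * b ^ r * fact r" 0] c b
    unfolding h_def by (simp add: abs_mult power_abs)
  also have "\<dots> \<le> ereal M"
    using M by simp
  finally show "\<exists>h. has_weak_deriv r g h \<and> h \<in> Linf {0..1} \<and> Linf_norm {0..1} h \<le> ereal M"
    using weak[of r] Linf by blast
qed

section \<open>Fooling functions\<close>

definition fooling :: "nat \<Rightarrow> 'd::finite set \<Rightarrow> real ^ 'd \<Rightarrow> real" where
  "fooling r T x = (\<Prod>i\<in>UNIV. half_tpow (i \<in> T) r (x $ i))"

lemma fooling_in_F_class:
  assumes "1 \<le> r" "2 ^ r * fact r \<le> M"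
  shows "fooling r T \<in> F_class r M"
  using half_tpow_admissible[OF assms, of 1] unfolding F_class_def fooling_def
  by (auto intro!: exI[of _ "\<lambda>i. half_tpow (i \<in> T) r"])

lemma uminus_fooling_in_F_class:
  fixes T :: "'d::finite set"
  assumes "1 \<le> r" "2 ^ r * fact r \<le> M"
  shows "(\<lambda>x. - fooling r T x) \<in> F_class r M"
proof -
  \<comment> \<open>The sign is absorbed into the factor of one arbitrary coordinate
    \<open>i0\<close>.\<close>
  fix i0 :: 'd
  define c where "c i = (if i = i0 then -1 else 1 :: real)" for i
  have c: "\<bar>c i\<bar> = 1" for i
    by (simp add: c_def)
  have "(\<Prod>i\<in>UNIV. c i) = -1"
    by (simp add: c_def prod.delta)
  then have "- fooling r T x = (\<Prod>i\<in>UNIV. c i * half_tpow (i \<in> T) r (x $ i))" for x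
    by (simp add: fooling_def prod.distrib)
  with half_tpow_admissible[OF assms c] show ?thesis
    unfolding F_class_def by (auto intro!: exI[of _ "\<lambda>i x. c i * half_tpow (i \<in> T) r x"])
qed

text \<open>A nonzero product has only nonzero factors, and each factor reveals on which side of
  \<open>1 / 2\<close> its coordinate lies. So a point recovers \<open>T\<close>, and distinct sets
  \<open>T\<close> have disjoint nonzero sets.\<close>

lemma fooling_nonzero_imp_eq:
  assumes "fooling r T x \<noteq> 0"
  shows "T = {i. 1 / 2 < x $ i}"
proof -
  have "half_tpow (i \<in> T) r (x $ i) \<noteq> 0" for i
    using assms by (simp add: fooling_def)
  then show ?thesis
    unfolding half_tpow_eq_0_iff by (force split: if_splits)
qed

lemma fooling_vertex: "fooling r T (\<chi> i. if i \<in> T then 1 else 0) = 1"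
  by (auto simp: fooling_def half_tpow_def tpow_def intro!: prod.neutral)

text \<open>Pigeonhole: each point of \<open>X\<close> rules out at most one of the
  \<open>2 ^ CARD('d)\<close> sets \<open>T\<close>.\<close>

lemma exists_fooling_vanishing:
  fixes X :: "(real ^ 'd::finite) set"
  assumes "finite X" "card X < 2 ^ CARD('d)"
  obtains T where "\<And>x. x \<in> X \<Longrightarrow> fooling r T x = 0"
proof -
  have "card ((\<lambda>x. {i. 1 / 2 < x $ i}) ` X) < card (UNIV :: 'd set set)"
    using le_less_trans[OF card_image_le[OF assms(1)] assms(2)]
      card_Pow[of "UNIV :: 'd set"] by simp
  then have "(\<lambda>x. {i. 1 / 2 < x $ i}) ` X \<noteq> UNIV"
    by (rule contrapos_pn) simp
  then obtain T where T: "T \<notin> (\<lambda>x. {i. 1 / 2 < x $ i}) ` X"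
    by blast
  show ?thesis
  proof (rule that)
    show "fooling r T x = 0" if "x \<in> X" for x
      using T fooling_nonzero_imp_eq[of r T x] that by auto
  qed
qed

text \<open>As long as all answers are \<open>0\<close>, an adaptive method asks at the
  predetermined points \<open>\<psi> (replicate j 0)\<close>, so vanishing there is enough to fix
  the whole record.\<close>

lemma info_eq_replicate_0:
  assumes "\<And>j. j < n \<Longrightarrow> f (\<psi> (replicate j 0)) = 0"
  shows "info \<psi> f n = replicate n 0"
  using assms by (induction n) (auto simp: replicate_append_same)

section \<open>The minimal error\<close>

lemma box_vec_0_1_ne: "box 0 (1 :: real ^ 'd::finite) \<noteq> {}"
  by (auto simp: box_ne_empty Basis_vec_def inner_axis)

text \<open>With \<open>f = fooling r T\<close>, the identity
  \<open>2 * f = (f - g) - (- f - g)\<close> shows that a common error bound \<open>c < 1\<close>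
  would also bound the modulus of \<open>f\<close> almost everywhere, contradicting the value
  \<open>1\<close> at a vertex.\<close>

lemma fooling_error_ge_1:
  fixes T :: "'d::finite set"
  assumes "1 \<le> r"
  shows "1 \<le> max (Linf_norm (cbox 0 1) (\<lambda>x. fooling r T x - g x))
               (Linf_norm (cbox 0 1) (\<lambda>x. - fooling r T x - g x))"
proof (rule ccontr)
  let ?e1 = "Linf_norm (cbox 0 1) (\<lambda>x. fooling r T x - g x)"
  let ?e2 = "Linf_norm (cbox 0 1) (\<lambda>x. - fooling r T x - g x)"
  assume "\<not> ?thesis"
  then have "max ?e1 ?e2 < 1"
    unfolding not_le .
  from ereal_dense2[OF this] obtain c where c: "max ?e1 ?e2 < ereal c" "ereal c < 1"
    by blast
  then have le: "?e1 \<le> ereal c" "?e2 \<le> ereal c"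
    unfolding max_less_iff_conj by (blast intro: less_imp_le)+
  have "AE x in lebesgue. x \<in> cbox 0 1 \<longrightarrow> \<bar>fooling r T x - g x\<bar> \<le> c"
       "AE x in lebesgue. x \<in> cbox 0 1 \<longrightarrow> \<bar>- fooling r T x - g x\<bar> \<le> c"
    by (rule Linf_norm_AE_le[OF _ le(1)], simp) (rule Linf_norm_AE_le[OF _ le(2)], simp)
  then have AE: "AE x in lebesgue. x \<in> cbox 0 1 \<longrightarrow> \<bar>fooling r T x\<bar> \<le> c"
    by eventually_elim auto
  obtain r' where "r = Suc r'"
    using assms by (cases r) auto
  then have cont: "continuous_on UNIV (half_tpow u r)" for u
    by (cases u) (simp_all add: half_tpow_def tpow_Suc_continuous)
  have "continuous_on (cbox 0 1) (\<lambda>x. half_tpow (i \<in> T) r (x $ i))" for i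
    by (rule continuous_on_compose2[OF cont]) (auto intro: continuous_on_component continuous_on_id)
  then have "continuous_on (cbox 0 1) (fooling r T)"
    unfolding fooling_def by (rule continuous_on_prod)
  \<comment> \<open>The vertex lies in the null boundary of the cube, so continuity is what carries
    the almost everywhere bound to it.\<close>
  then have "\<bar>fooling r T (\<chi> i. if i \<in> T then 1 else 0)\<bar> \<le> c"
    by (rule continuous_AE_bound_cbox[OF _ box_vec_0_1_ne AE]) (auto simp: mem_box_cart)
  then show False
    using \<open>ereal c < 1\<close> by (simp add: fooling_vertex)
qed

text \<open>The norm bounds on the factors hold pointwise because the factors are continuous, and
  both properties pass to the product. This bounds the error of the zero algorithm.\<close>

lemma F_class_abs_le_1:
  fixes f :: "real ^ 'd::finite \<Rightarrow> real"
  assumes "f \<in> F_class r M"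
  shows "continuous_on (cbox 0 1) f" "\<And>x. x \<in> cbox 0 1 \<Longrightarrow> \<bar>f x\<bar> \<le> 1"
proof -
  obtain fs :: "'d \<Rightarrow> real \<Rightarrow> real" where fs: "\<And>i. fs i \<in> W_inf r" "\<And>i. Linf_norm {0..1} (fs i) \<le> 1"
    and f: "\<And>x. x \<in> cbox 0 1 \<Longrightarrow> f x = (\<Prod>i\<in>UNIV. fs i (x $ i))"
    using assms unfolding F_class_def by blast
  have cont: "continuous_on {0..1} (fs i)" for i
    using fs(1) by (simp add: W_inf_def)
  have "AE x in lebesgue. x \<in> {0..1} \<longrightarrow> \<bar>fs i x\<bar> \<le> 1" for i
    using fs(2)[of i] by (intro Linf_norm_AE_le) (auto simp: one_ereal_def)
  then have le: "\<bar>fs i x\<bar> \<le> 1" if "x \<in> {0..1}" for i x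
    using continuous_AE_bound_cbox[of 0 1 "fs i" 1 x] cont that by simp
  have "continuous_on (cbox 0 1) (\<lambda>x. \<Prod>i\<in>UNIV. fs i (x $ i))"
    by (intro continuous_on_prod continuous_on_compose2[OF cont] continuous_intros)
      (auto simp: mem_box_cart)
  then show "continuous_on (cbox 0 1) f"
    by (rule continuous_on_eq) (simp add: f)
  show "\<bar>f x\<bar> \<le> 1" if "x \<in> cbox 0 1" for x
    using that le by (auto simp: f abs_prod mem_box_cart intro!: prod_le_1)
qed

lemma e_det_F_class_le_1: "e_det n (F_class r M :: (real ^ 'd::finite \<Rightarrow> real) set) \<le> 1"
proof -
  have cbox: "cbox 0 (1 :: real ^ 'd) \<in> sets lebesgue"
    by simp
  have "(\<lambda>f x. 0) \<in> (det_algorithms n :: ((real ^ 'd \<Rightarrow> real) \<Rightarrow> _) set)"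
    unfolding det_algorithms_def
    by (intro CollectI exI[of _ "\<lambda>_. 0"] exI[of _ "\<lambda>_ _. 0"])
      (auto simp: mem_box_cart intro!: LinfI[of _ _ 0])
  then have "e_det n (F_class r M :: (real ^ 'd \<Rightarrow> real) set) \<le> e_det_alg (\<lambda>f x. 0) (F_class r M :: (real ^ 'd \<Rightarrow> real) set)"
    unfolding e_det_def by (rule INF_lower)
  also have "\<dots> \<le> 1"
    unfolding e_det_alg_def
  proof (rule SUP_least)
    fix f :: "real ^ 'd \<Rightarrow> real" assume f: "f \<in> F_class r M"
    show "Linf_norm (cbox 0 1) (\<lambda>x. f x - 0) \<le> 1"
      using Linf_norm_leI[OF continuous_imp_measurable_on_sets_lebesgue cbox, of f 1]
        F_class_abs_le_1[OF f] by (simp add: one_ereal_def)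
  qed
  finally show ?thesis .
qed

lemma e_det_F_class_ge_1:
  assumes "1 \<le> r" "2 ^ r * fact r \<le> M" "n < 2 ^ CARD('d::finite)"
  shows "1 \<le> e_det n (F_class r M :: (real ^ 'd \<Rightarrow> real) set)"
  unfolding e_det_def
proof (rule INF_greatest)
  fix A :: "(real ^ 'd \<Rightarrow> real) \<Rightarrow> real ^ 'd \<Rightarrow> real"
  assume "A \<in> det_algorithms n"
  then obtain \<psi> \<phi> where A: "\<And>f. A f = \<phi> (info \<psi> f n)"
    unfolding det_algorithms_def by blast
  \<comment> \<open>These are the at most \<open>n\<close> points queried when every answer is
    \<open>0\<close>.\<close>
  define X where "X = (\<lambda>j. \<psi> (replicate j 0)) ` {..<n}"
  have "finite X" "card X < 2 ^ CARD('d)"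
    using card_image_le[of "{..<n}" "\<lambda>j. \<psi> (replicate j 0)"] assms(3) by (auto simp: X_def)
  then obtain T where T: "\<And>x. x \<in> X \<Longrightarrow> fooling r T x = 0"
    using exists_fooling_vanishing by blast
  define g where "g = \<phi> (replicate n 0)"
  \<comment> \<open>Both functions vanish on \<open>X\<close>, so both yield the record
    \<open>replicate n 0\<close> and the same output.\<close>
  have A_eq: "A (fooling r T) = g" "A (\<lambda>x. - fooling r T x) = g"
    using T unfolding A g_def by (auto simp: X_def info_eq_replicate_0)
  have "1 \<le> max (Linf_norm (cbox 0 1) (\<lambda>x. fooling r T x - A (fooling r T) x))
      (Linf_norm (cbox 0 1) (\<lambda>x. - fooling r T x - A (\<lambda>x. - fooling r T x) x))"
    unfolding A_eq by (rule fooling_error_ge_1[OF assms(1)])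
  also have "\<dots> \<le> e_det_alg A (F_class r M)"
    unfolding e_det_alg_def
  proof (rule max.boundedI)
    let ?err = "\<lambda>f. Linf_norm (cbox 0 1) (\<lambda>x. f x - A f x)"
    show "?err (fooling r T) \<le> (SUP f\<in>F_class r M. ?err f)"
      by (rule SUP_upper[OF fooling_in_F_class[OF assms(1,2)]])
    show "?err (\<lambda>x. - fooling r T x) \<le> (SUP f\<in>F_class r M. ?err f)"
      by (rule SUP_upper[OF uminus_fooling_in_F_class[OF assms(1,2)]])
  qed
  finally show "1 \<le> e_det_alg A (F_class r M)" .
qed

theorem theorem2:
  fixes r n :: nat and M :: real
  assumes "1 \<le> r"
    and "2 ^ r * fact r \<le> M"
    and "n \<in> {1..2 ^ CARD('d::finite) - 1}"
  shows "e_det n (F_class r M :: (real ^ 'd \<Rightarrow> real) set) = 1"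
proof (rule antisym)
  have "n < 2 ^ CARD('d)"
    using assms(3) by auto
  then show "1 \<le> e_det n (F_class r M :: (real ^ 'd \<Rightarrow> real) set)"
    by (rule e_det_F_class_ge_1[OF assms(1,2)])
qed (rule e_det_F_class_le_1)

end
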